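(* Let $\mathcal B\to\mathbb B$ be a material bundle which is a vector bundle. For $F\in\mathrm{Conf}_{lin}(T\mathcal B,T\mathcal E)$, the data of $\mathfrak G=F^*\mathfrak g$ is equivalent to the joint data of the micro-metric $\mathfrak G_v^v$ (the restriction of $\mathfrak G$ to $V\mathcal B$), the connection $\Gamma=F^*\gamma$ and the solder form $\Theta=F^*\vartheta$; that is, for any $F,F'\in\mathrm{Conf}_{lin}(T\mathcal B,T\mathcal E)$ with associated objects $(\mathfrak G,\Gamma,\Theta)$ and $(\mathfrak G',\Gamma',\Theta')$, $$\mathfrak G=\mathfrak G'\iff\big(\mathfrak G_v^v={\mathfrak G'}_v^v,\ \Gamma=\Gamma'\ \text{ and }\ \Theta=\Theta'\big).$$
   Context: Smooth means at least $C^1$. Bundles. An affine (resp. vector) bundle $\pi_{A}:A\to\mathbb A$ is a smooth surjection between smooth connected orientable manifolds which is locally trivial with typical fibre a finite-dimensional real affine (resp. vector) space $F_A$, with transition maps affine (resp. linear) on the fibres; its rank is $\dim F_A$. Affine (resp. linear) trivialising coordinates are local coordinates $(\bar x,y)$ on $A$ with $\bar x$ coordinates on $\mathbb A$ and $y$ affine (resp. linear) coordinates on each fibre; they induce coordinates $(\bar x,y,\delta\bar x,\delta y)$ on $TA$ ("vectorial coordinates" $(\delta \bar x,\delta y)$). $VA=\ker T\pi_A\subset TA$. Ambient space. $\mathbb E=\mathbb R^3$ with Euclidean metric $\mathbf g$; $\mathcal E=\mathbb R^3\times\mathbb R^3\ni(\bar x,y)$ with $\pi_{\mathcal E}(\bar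 x,y)=\bar x$, a vector bundle. In the canonical coordinates, the connection is $\gamma_{(\bar x,y)}(\delta\bar x)=((\bar x,y),(\delta\bar x,0))$, the solder form is $\vartheta_{(\bar x,y)}(\delta\bar x)=((\bar x,y),(0,\delta\bar x))$, and the pseudo-metric is $\mathfrak g=\iota^*\mathbf g$ with $\iota:T\mathcal E\to T\mathbb E$, $((\bar x,y),(\delta\bar x,\delta y))\mapsto(\bar x,\delta\bar x+\delta y)$. Material bundle. $\pi_{\mathcal B}:\mathcal B\to\mathbb B$ has rank $3$ and $\dim\mathbb B\in\{1,2,3\}$. Placements. For affine bundles $A\to\mathbb A$, $D\to\mathbb D$, $\mathrm{Aff}(A,D)$ is the set of smooth maps $\ell:A\to D$ such that there is a smooth $\bar\ell:\mathbb A\to\mathbb D$ with $\pi_D\circ\ell=\bar\ell\circ\pi_A$, and $\ell$ is affine on each fibre. A smooth map $L:TA\to TD$ is physically acceptable, $L\in\mathcal L_{pa}(TA,TD)$, if: (1) $L$ is a vector bundle morphism $TA\to TD$ over some $\ell\in\mathrm{Aff}(A,D)$ (its punctual shadow); (2) $T\pi_D\circ L=\bar L\circ T\pi_A$ with $\bar L:=T\bar\ell$; (3) $L|_{VA}=(T\ell)|_{VA}$; (4) in affine trivialising coordinates, the vectorial coordinates of $L_a u$ (for fixed vectorial coordinates of $u\in T_aA$) are affine in the vertical coordinate $y$ of $a$. $\mathrm{Conf}(T\mathcal B,T\mathcal E)$ is the set of $F\in\mathcal L_{pa}(T\mathcal B,T\mathcal E)$ that are differential embeddings and whose punctual shadow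 $\varphi$ is a differential embedding. Micro-linearity. If $A,D$ are vector bundles, $L\in\mathcal L_{pa}(TA,TD)$ is micro-linear if its punctual shadow $\ell$ is linear on each fibre and, in linear trivialising coordinates, the coupling block of $L$ (the linear map sending $\delta\bar x$ to the $\delta y$-component of $L_{(\bar x,y)}(\delta\bar x,0)$) is linear in $y$. $\mathrm{Conf}_{lin}(T\mathcal B,T\mathcal E)$ is the set of micro-linear elements of $\mathrm{Conf}(T\mathcal B,T\mathcal E)$. Pull-backs. $(F^*\gamma)_X=F_X^{-1}\circ\gamma_{\varphi(X)}\circ\bar F$ and $(F^*\vartheta)_X=F_X^{-1}\circ\vartheta_{\varphi(X)}\circ\bar F$ for $X\in\mathcal B$ (maps $T_{\bar X}\mathbb B\to T_X\mathcal B$); $\langle U,W\rangle_{F^*\mathfrak g}=\langle FU,FW\rangle_{\mathfrak g}$. *)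

theory Defs
  imports "HOL-Analysis.Analysis"
begin

section \<open>Manifolds with a finite-dimensional model space\<close>

text \<open>Class \<open>C\<^sup>k\<close> on an open set. All directional derivatives being of class
  \<open>C\<^sup>k\<close> is, in finite dimension, the same as the derivative being of class \<open>C\<^sup>k\<close>.\<close>

primrec Ck_on :: "nat \<Rightarrow> ('v::euclidean_space \<Rightarrow> 'w::euclidean_space) \<Rightarrow> 'v set \<Rightarrow> bool" where
  "Ck_on 0 f S \<longleftrightarrow> continuous_on S f"
| "Ck_on (Suc k) f S \<longleftrightarrow>
     (\<exists>f'. (\<forall>x\<in>S. (f has_derivative f' x) (at x)) \<and> (\<forall>v. Ck_on k (\<lambda>x. f' x v) S))"

text \<open>A chart is its domain together with the coordinate map; values of the coordinate map
  outside the domain are irrelevant.\<close>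

type_synonym ('m, 'v) chart = "'m set \<times> ('m \<Rightarrow> 'v)"

record ('m, 'v) manifold =
  space_of :: "'m topology"
  atlas :: "('m, 'v) chart set"

text \<open>The local representation \<open>d \<circ> f \<circ> c\<^sup>-\<^sup>1\<close>, its set of definition, and its differential
  at the point with coordinates \<open>c p\<close>.\<close>

definition local_rep :: "('m, 'v) chart \<Rightarrow> ('n, 'w) chart \<Rightarrow> ('m \<Rightarrow> 'n) \<Rightarrow> 'v \<Rightarrow> 'w" where
  "local_rep c d f = snd d \<circ> f \<circ> inv_into (fst c) (snd c)"

definition local_dom :: "('m, 'v) chart \<Rightarrow> ('n, 'w) chart \<Rightarrow> ('m \<Rightarrow> 'n) \<Rightarrow> 'v set" where
  "local_dom c d f = snd c ` {p \<in> fst c. f p \<in> fst d}"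

definition local_deriv ::
  "('m, 'v::euclidean_space) chart \<Rightarrow> ('n, 'w::euclidean_space) chart \<Rightarrow> ('m \<Rightarrow> 'n) \<Rightarrow> 'm \<Rightarrow> 'v \<Rightarrow> 'w" where
  "local_deriv c d f p = frechet_derivative (local_rep c d f) (at (snd c p))"

definition is_chart :: "'m topology \<Rightarrow> ('m, 'v::euclidean_space) chart \<Rightarrow> bool" where
  "is_chart X c \<longleftrightarrow> openin X (fst c) \<and> open (snd c ` fst c) \<and>
     homeomorphic_map (subtopology X (fst c)) (top_of_set (snd c ` fst c)) (snd c)"

definition manifold_of_class :: "nat \<Rightarrow> ('m, 'v::euclidean_space) manifold \<Rightarrow> bool" where
  "manifold_of_class k M \<longleftrightarrow>
     Hausdorff_space (space_of M) \<and> second_countable (space_of M) \<and>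
     (\<Union>c\<in>atlas M. fst c) = topspace (space_of M) \<and>
     (\<forall>c\<in>atlas M. is_chart (space_of M) c) \<and>
     (\<forall>c\<in>atlas M. \<forall>d\<in>atlas M. Ck_on k (local_rep c d id) (local_dom c d id))"

text \<open>Determinant of an endomorphism in the standard orthonormal basis (Leibniz formula).\<close>

definition endo_det :: "('v::euclidean_space \<Rightarrow> 'v) \<Rightarrow> real" where
  "endo_det h = (\<Sum>s | s permutes (Basis :: 'v set).
     of_int (sign s) * (\<Prod>b\<in>Basis. h b \<bullet> s b))"

text \<open>Orientability: some covering family of charts, compatible with the atlas, has transition
  maps with positive Jacobian.\<close>

definition orientable :: "nat \<Rightarrow> ('m, 'v::euclidean_space) manifold \<Rightarrow> bool" where
  "orientable k M \<longleftrightarrow>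
     (\<exists>Or. manifold_of_class k (M\<lparr>atlas := atlas M \<union> Or\<rparr>) \<and>
        (\<Union>c\<in>Or. fst c) = topspace (space_of M) \<and>
        (\<forall>c\<in>Or. \<forall>d\<in>Or. \<forall>p\<in>fst c \<inter> fst d. endo_det (local_deriv c d id p) > 0))"

text \<open>Smooth maps are maps of class \<open>C\<^sup>1\<close>.\<close>

definition smooth_map ::
  "('m, 'v::euclidean_space) manifold \<Rightarrow> ('n, 'w::euclidean_space) manifold \<Rightarrow> ('m \<Rightarrow> 'n) \<Rightarrow> bool" where
  "smooth_map M N f \<longleftrightarrow> continuous_map (space_of M) (space_of N) f \<and>
     (\<forall>c\<in>atlas M. \<forall>d\<in>atlas N. Ck_on 1 (local_rep c d f) (local_dom c d f))"


section \<open>Tangent bundles\<close>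

text \<open>A tangent vector at \<open>p\<close> is encoded by the family of its coordinate vectors in all charts
  around \<open>p\<close>; the members of the family are related by the differentials of the transition maps.
  The value at anything that is not a chart around \<open>p\<close> is fixed to be \<open>0\<close>, so that this
  encoding is unique, and the vector space operations are the pointwise ones.\<close>

type_synonym ('m, 'v) tvec = "'m \<times> (('m, 'v) chart \<Rightarrow> 'v)"

definition tangent_space ::
  "('m, 'v::euclidean_space) manifold \<Rightarrow> 'm \<Rightarrow> (('m, 'v) chart \<Rightarrow> 'v) set" where
  "tangent_space M p = {\<xi>.
     (\<forall>c. \<not> (c \<in> atlas M \<and> p \<in> fst c) \<longrightarrow> \<xi> c = 0) \<and>
     (\<forall>c\<in>atlas M. \<forall>d\<in>atlas M. p \<in> fst c \<inter> fst d \<longrightarrow> \<xi> d = local_deriv c d id p (\<xi> c))}"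

definition tangent_at :: "('m, 'v::euclidean_space) manifold \<Rightarrow> 'm \<Rightarrow> ('m, 'v) tvec set" where
  "tangent_at M p = {p} \<times> tangent_space M p"

definition tangent_vectors :: "('m, 'v::euclidean_space) manifold \<Rightarrow> ('m, 'v) tvec set" where
  "tangent_vectors M = (\<Union>p\<in>topspace (space_of M). tangent_at M p)"

definition tangent_chart ::
  "('m, 'v::euclidean_space) manifold \<Rightarrow> ('m, 'v) chart \<Rightarrow> (('m, 'v) tvec, 'v \<times> 'v) chart" where
  "tangent_chart M c =
     ({u \<in> tangent_vectors M. fst u \<in> fst c}, \<lambda>u. (snd c (fst u), snd u c))"

definition tangent_manifold ::
  "('m, 'v::euclidean_space) manifold \<Rightarrow> (('m, 'v) tvec, 'v \<times> 'v) manifold" where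
  "tangent_manifold M =
     \<lparr>space_of = topology_generated_by
        {{u \<in> fst (tangent_chart M c). snd (tangent_chart M c) u \<in> W} | c W. c \<in> atlas M \<and> open W},
      atlas = tangent_chart M ` atlas M\<rparr>"

definition tvec_of_coords ::
  "('m, 'v::euclidean_space) manifold \<Rightarrow> ('m, 'v) chart \<Rightarrow> 'm \<Rightarrow> 'v \<Rightarrow> ('m, 'v) tvec" where
  "tvec_of_coords M c p w =
     (p, \<lambda>d. if d \<in> atlas M \<and> p \<in> fst d then local_deriv c d id p w else 0)"

text \<open>The tangent map, computed in an arbitrary chart of the source; for smooth maps between
  manifolds of class \<open>C\<^sup>1\<close> the result does not depend on that chart.\<close>

definition tangent_map ::
  "('m, 'v::euclidean_space) manifold \<Rightarrow> ('n, 'w::euclidean_space) manifold \<Rightarrow> ('m \<Rightarrow> 'n) \<Rightarrow>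
   ('m, 'v) tvec \<Rightarrow> ('n, 'w) tvec" where
  "tangent_map M N f u =
     (let c = (SOME c. c \<in> atlas M \<and> fst u \<in> fst c)
      in (f (fst u), \<lambda>d. if d \<in> atlas N \<and> f (fst u) \<in> fst d
                         then local_deriv c d f (fst u) (snd u c) else 0))"

text \<open>Injective immersions that are homeomorphisms onto their image.\<close>

definition diff_embedding ::
  "('m, 'v::euclidean_space) manifold \<Rightarrow> ('n, 'w::euclidean_space) manifold \<Rightarrow> ('m \<Rightarrow> 'n) \<Rightarrow> bool" where
  "diff_embedding M N f \<longleftrightarrow> smooth_map M N f \<and> embedding_map (space_of M) (space_of N) f \<and>
     (\<forall>p\<in>topspace (space_of M). inj_on (tangent_map M N f) (tangent_at M p))"


section \<open>Affine and vector bundles\<close>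

text \<open>Trivialising coordinates over an open subset of the base: base coordinates \<open>xc\<close> and fibre
  coordinates \<open>yc\<close>.\<close>

record ('m, 'b, 'x, 'y) trivialisation =
  tdom :: "'b set"
  xc :: "'b \<Rightarrow> 'x"
  yc :: "'m \<Rightarrow> 'y"

record ('m, 'b, 'x, 'y) fibre_bundle =
  total_space :: "'m topology"
  base_space :: "'b topology"
  proj :: "'m \<Rightarrow> 'b"
  trivs :: "('m, 'b, 'x, 'y) trivialisation set"

abbreviation points :: "('m, 'b, 'x, 'y) fibre_bundle \<Rightarrow> 'm set" where
  "points A \<equiv> topspace (total_space A)"

abbreviation base_points :: "('m, 'b, 'x, 'y) fibre_bundle \<Rightarrow> 'b set" where
  "base_points A \<equiv> topspace (base_space A)"

definition base_chart :: "('m, 'b, 'x, 'y) trivialisation \<Rightarrow> ('b, 'x) chart" where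
  "base_chart c = (tdom c, xc c)"

definition total_chart ::
  "('m, 'b, 'x, 'y) fibre_bundle \<Rightarrow> ('m, 'b, 'x, 'y) trivialisation \<Rightarrow> ('m, 'x \<times> 'y) chart" where
  "total_chart A c = ({a \<in> points A. proj A a \<in> tdom c}, \<lambda>a. (xc c (proj A a), yc c a))"

definition base_manifold :: "('m, 'b, 'x, 'y) fibre_bundle \<Rightarrow> ('b, 'x) manifold" where
  "base_manifold A = \<lparr>space_of = base_space A, atlas = base_chart ` trivs A\<rparr>"

definition total_manifold :: "('m, 'b, 'x, 'y) fibre_bundle \<Rightarrow> ('m, 'x \<times> 'y) manifold" where
  "total_manifold A = \<lparr>space_of = total_space A, atlas = total_chart A ` trivs A\<rparr>"

definition affine_map :: "('v::real_vector \<Rightarrow> 'w::real_vector) \<Rightarrow> bool" where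
  "affine_map g \<longleftrightarrow> (\<exists>h b. linear h \<and> g = (\<lambda>y. h y + b))"

text \<open>The manifolds are of class \<open>C\<^sup>2\<close>, the weakest class for which their tangent bundles are
  of class \<open>C\<^sup>1\<close>, so that smoothness of maps between tangent bundles makes sense.\<close>

definition smooth_bundle ::
  "('m, 'b, 'x::euclidean_space, 'y::euclidean_space) fibre_bundle \<Rightarrow> bool" where
  "smooth_bundle A \<longleftrightarrow>
     manifold_of_class 2 (base_manifold A) \<and> connected_space (base_space A) \<and>
     orientable 2 (base_manifold A) \<and>
     manifold_of_class 2 (total_manifold A) \<and> connected_space (total_space A) \<and>
     orientable 2 (total_manifold A) \<and>
     smooth_map (total_manifold A) (base_manifold A) (proj A) \<and>
     proj A ` points A = base_points A \<and>
     (\<forall>c\<in>trivs A. snd (total_chart A c) ` fst (total_chart A c) = xc c ` tdom c \<times> UNIV)"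

definition affine_bundle ::
  "('m, 'b, 'x::euclidean_space, 'y::euclidean_space) fibre_bundle \<Rightarrow> bool" where
  "affine_bundle A \<longleftrightarrow> smooth_bundle A \<and>
     (\<forall>c\<in>trivs A. \<forall>d\<in>trivs A. \<forall>x\<in>tdom c \<inter> tdom d.
        \<exists>g. affine_map g \<and> (\<forall>a\<in>points A. proj A a = x \<longrightarrow> yc d a = g (yc c a)))"

definition vector_bundle ::
  "('m, 'b, 'x::euclidean_space, 'y::euclidean_space) fibre_bundle \<Rightarrow> bool" where
  "vector_bundle A \<longleftrightarrow> smooth_bundle A \<and>
     (\<forall>c\<in>trivs A. \<forall>d\<in>trivs A. \<forall>x\<in>tdom c \<inter> tdom d.
        \<exists>g. linear g \<and> (\<forall>a\<in>points A. proj A a = x \<longrightarrow> yc d a = g (yc c a)))"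

definition material_bundle ::
  "('m, 'b, 'x::euclidean_space, 'y::euclidean_space) fibre_bundle \<Rightarrow> bool" where
  "material_bundle B \<longleftrightarrow> affine_bundle B \<and> DIM('y) = 3 \<and> DIM('x) \<in> {1, 2, 3}"

abbreviation TT ::
  "('m, 'b, 'x::euclidean_space, 'y::euclidean_space) fibre_bundle \<Rightarrow>
   (('m, 'x \<times> 'y) tvec, ('x \<times> 'y) \<times> ('x \<times> 'y)) manifold" where
  "TT A \<equiv> tangent_manifold (total_manifold A)"

definition Tproj ::
  "('m, 'b, 'x::euclidean_space, 'y::euclidean_space) fibre_bundle \<Rightarrow>
   ('m, 'x \<times> 'y) tvec \<Rightarrow> ('b, 'x) tvec" where
  "Tproj A = tangent_map (total_manifold A) (base_manifold A) (proj A)"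

definition vertical_at ::
  "('m, 'b, 'x::euclidean_space, 'y::euclidean_space) fibre_bundle \<Rightarrow> 'm \<Rightarrow> ('m, 'x \<times> 'y) tvec set" where
  "vertical_at A a = {u \<in> tangent_at (total_manifold A) a. snd (Tproj A u) = (\<lambda>_. 0)}"


section \<open>Physically acceptable maps\<close>

text \<open>The only candidate for the base map of a fibre-preserving map.\<close>

definition base_map ::
  "('m, 'b, 'x, 'y) fibre_bundle \<Rightarrow> ('n, 'e, 'z, 'w) fibre_bundle \<Rightarrow> ('m \<Rightarrow> 'n) \<Rightarrow> 'b \<Rightarrow> 'e" where
  "base_map A D l x = proj D (l (SOME a. a \<in> points A \<and> proj A a = x))"

definition Aff ::
  "('m, 'b, 'x::euclidean_space, 'y::euclidean_space) fibre_bundle \<Rightarrow>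
   ('n, 'e, 'z::euclidean_space, 'w::euclidean_space) fibre_bundle \<Rightarrow> ('m \<Rightarrow> 'n) set" where
  "Aff A D = {l. smooth_map (total_manifold A) (total_manifold D) l \<and>
     smooth_map (base_manifold A) (base_manifold D) (base_map A D l) \<and>
     (\<forall>a\<in>points A. proj D (l a) = base_map A D l (proj A a)) \<and>
     (\<forall>c\<in>trivs A. \<forall>d\<in>trivs D. \<forall>x\<in>tdom c. base_map A D l x \<in> tdom d \<longrightarrow>
        (\<exists>g. affine_map g \<and> (\<forall>a\<in>points A. proj A a = x \<longrightarrow> yc d (l a) = g (yc c a))))}"

text \<open>The map covered by \<open>L\<close> (the punctual shadow), read off on the zero section.\<close>

definition shadow ::
  "(('m, 'v::euclidean_space) tvec \<Rightarrow> ('n, 'w::euclidean_space) tvec) \<Rightarrow> 'm \<Rightarrow> 'n" where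
  "shadow L a = fst (L (a, \<lambda>_. 0))"

definition base_tangent_map ::
  "('m, 'b, 'x::euclidean_space, 'y::euclidean_space) fibre_bundle \<Rightarrow>
   ('n, 'e, 'z::euclidean_space, 'w::euclidean_space) fibre_bundle \<Rightarrow>
   (('m, 'x \<times> 'y) tvec \<Rightarrow> ('n, 'z \<times> 'w) tvec) \<Rightarrow> ('b, 'x) tvec \<Rightarrow> ('e, 'z) tvec" where
  "base_tangent_map A D L =
     tangent_map (base_manifold A) (base_manifold D) (base_map A D (shadow L))"

definition vb_morphism_over ::
  "('m, 'v::euclidean_space) manifold \<Rightarrow> ('n, 'w::euclidean_space) manifold \<Rightarrow> ('m \<Rightarrow> 'n) \<Rightarrow>
   (('m, 'v) tvec \<Rightarrow> ('n, 'w) tvec) \<Rightarrow> bool" where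
  "vb_morphism_over M N l L \<longleftrightarrow>
     (\<forall>a\<in>topspace (space_of M).
        (\<forall>u\<in>tangent_at M a. L u \<in> tangent_at N (l a)) \<and>
        (\<forall>\<xi>\<in>tangent_space M a. \<forall>\<eta>\<in>tangent_space M a. \<forall>r s.
           snd (L (a, \<lambda>c. r *\<^sub>R \<xi> c + s *\<^sub>R \<eta> c)) =
             (\<lambda>d. r *\<^sub>R snd (L (a, \<xi>)) d + s *\<^sub>R snd (L (a, \<eta>)) d)))"

text \<open>For a trivialisation \<open>c\<close>, the coordinate vector \<open>snd u (total_chart A c)\<close> of a tangent
  vector \<open>u\<close> is the pair of its vectorial coordinates.\<close>

definition phys_acceptable ::
  "('m, 'b, 'x::euclidean_space, 'y::euclidean_space) fibre_bundle \<Rightarrow>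
   ('n, 'e, 'z::euclidean_space, 'w::euclidean_space) fibre_bundle \<Rightarrow>
   (('m, 'x \<times> 'y) tvec \<Rightarrow> ('n, 'z \<times> 'w) tvec) set" where
  "phys_acceptable A D = {L.
     smooth_map (TT A) (TT D) L \<and>
     shadow L \<in> Aff A D \<and>
     vb_morphism_over (total_manifold A) (total_manifold D) (shadow L) L \<and>
     (\<forall>u\<in>tangent_vectors (total_manifold A).
        Tproj D (L u) = base_tangent_map A D L (Tproj A u)) \<and>
     (\<forall>a\<in>points A. \<forall>u\<in>vertical_at A a.
        L u = tangent_map (total_manifold A) (total_manifold D) (shadow L) u) \<and>
     (\<forall>c\<in>trivs A. \<forall>d\<in>trivs D. \<forall>x\<in>tdom c. \<forall>w.
        base_map A D (shadow L) x \<in> tdom d \<longrightarrow>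
        (\<exists>g. affine_map g \<and>
          (\<forall>u\<in>tangent_vectors (total_manifold A).
             proj A (fst u) = x \<and> snd u (total_chart A c) = w \<longrightarrow>
             snd (L u) (total_chart D d) = g (yc c (fst u)))))}"

definition Conf ::
  "('m, 'b, 'x::euclidean_space, 'y::euclidean_space) fibre_bundle \<Rightarrow>
   ('n, 'e, 'z::euclidean_space, 'w::euclidean_space) fibre_bundle \<Rightarrow>
   (('m, 'x \<times> 'y) tvec \<Rightarrow> ('n, 'z \<times> 'w) tvec) set" where
  "Conf A D = {F \<in> phys_acceptable A D. diff_embedding (TT A) (TT D) F \<and>
     diff_embedding (total_manifold A) (total_manifold D) (shadow F)}"

definition micro_linear ::
  "('m, 'b, 'x::euclidean_space, 'y::euclidean_space) fibre_bundle \<Rightarrow>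
   ('n, 'e, 'z::euclidean_space, 'w::euclidean_space) fibre_bundle \<Rightarrow>
   (('m, 'x \<times> 'y) tvec \<Rightarrow> ('n, 'z \<times> 'w) tvec) \<Rightarrow> bool" where
  "micro_linear A D L \<longleftrightarrow>
     (\<forall>c\<in>trivs A. \<forall>d\<in>trivs D. \<forall>x\<in>tdom c. base_map A D (shadow L) x \<in> tdom d \<longrightarrow>
        (\<exists>g. linear g \<and> (\<forall>a\<in>points A. proj A a = x \<longrightarrow> yc d (shadow L a) = g (yc c a))) \<and>
        (\<forall>\<delta>x. \<exists>g. linear g \<and>
          (\<forall>u\<in>tangent_vectors (total_manifold A).
             proj A (fst u) = x \<and> snd u (total_chart A c) = (\<delta>x, 0) \<longrightarrow>
             snd (snd (L u) (total_chart D d)) = g (yc c (fst u)))))"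

definition Conf_lin ::
  "('m, 'b, 'x::euclidean_space, 'y::euclidean_space) fibre_bundle \<Rightarrow>
   ('n, 'e, 'z::euclidean_space, 'w::euclidean_space) fibre_bundle \<Rightarrow>
   (('m, 'x \<times> 'y) tvec \<Rightarrow> ('n, 'z \<times> 'w) tvec) set" where
  "Conf_lin A D = {F \<in> Conf A D. micro_linear A D F}"


section \<open>The ambient bundle\<close>

type_synonym vec3 = "real ^ 3"
type_synonym ambient_tvec = "(vec3 \<times> vec3, vec3 \<times> vec3) tvec"
type_synonym euclid_tvec = "(vec3, vec3) tvec"

definition canonical :: "(vec3 \<times> vec3, vec3, vec3, vec3) trivialisation" where
  "canonical = \<lparr>tdom = UNIV, xc = id, yc = snd\<rparr>"

definition ambient :: "(vec3 \<times> vec3, vec3, vec3, vec3) fibre_bundle" where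
  "ambient = \<lparr>total_space = euclidean, base_space = euclidean, proj = fst, trivs = {canonical}\<rparr>"

definition ambient_coords :: "ambient_tvec \<Rightarrow> vec3 \<times> vec3" where
  "ambient_coords U = snd U (total_chart ambient canonical)"

definition ambient_vec :: "vec3 \<times> vec3 \<Rightarrow> vec3 \<times> vec3 \<Rightarrow> ambient_tvec" where
  "ambient_vec = tvec_of_coords (total_manifold ambient) (total_chart ambient canonical)"

definition euclid_coords :: "euclid_tvec \<Rightarrow> vec3" where
  "euclid_coords u = snd u (base_chart canonical)"

definition euclid_vec :: "vec3 \<Rightarrow> vec3 \<Rightarrow> euclid_tvec" where
  "euclid_vec = tvec_of_coords (base_manifold ambient) (base_chart canonical)"

definition amb_connection :: "vec3 \<times> vec3 \<Rightarrow> euclid_tvec \<Rightarrow> ambient_tvec" where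
  "amb_connection p u = ambient_vec p (euclid_coords u, 0)"

definition amb_solder :: "vec3 \<times> vec3 \<Rightarrow> euclid_tvec \<Rightarrow> ambient_tvec" where
  "amb_solder p u = ambient_vec p (0, euclid_coords u)"

definition amb_iota :: "ambient_tvec \<Rightarrow> euclid_tvec" where
  "amb_iota U = euclid_vec (fst (fst U)) (fst (ambient_coords U) + snd (ambient_coords U))"

definition euclid_metric :: "euclid_tvec \<Rightarrow> euclid_tvec \<Rightarrow> real" where
  "euclid_metric u w = euclid_coords u \<bullet> euclid_coords w"

definition amb_metric :: "ambient_tvec \<Rightarrow> ambient_tvec \<Rightarrow> real" where
  "amb_metric U W = euclid_metric (amb_iota U) (amb_iota W)"


section \<open>Pull-backs\<close>

text \<open>All fields below are restricted to their domains, so that equality of HOL functions is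
  equality of the geometric objects.\<close>

definition pullback_metric ::
  "('m, 'b, 'x::euclidean_space, 'y::euclidean_space) fibre_bundle \<Rightarrow>
   (('m, 'x \<times> 'y) tvec \<Rightarrow> ambient_tvec) \<Rightarrow>
   'm \<Rightarrow> ('m, 'x \<times> 'y) tvec \<Rightarrow> ('m, 'x \<times> 'y) tvec \<Rightarrow> real" where
  "pullback_metric B F =
     (\<lambda>X\<in>points B. \<lambda>U\<in>tangent_at (total_manifold B) X. \<lambda>W\<in>tangent_at (total_manifold B) X.
        amb_metric (F U) (F W))"

definition micro_metric ::
  "('m, 'b, 'x::euclidean_space, 'y::euclidean_space) fibre_bundle \<Rightarrow>
   ('m \<Rightarrow> ('m, 'x \<times> 'y) tvec \<Rightarrow> ('m, 'x \<times> 'y) tvec \<Rightarrow> real) \<Rightarrow>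
   'm \<Rightarrow> ('m, 'x \<times> 'y) tvec \<Rightarrow> ('m, 'x \<times> 'y) tvec \<Rightarrow> real" where
  "micro_metric B G = (\<lambda>X\<in>points B. \<lambda>U\<in>vertical_at B X. \<lambda>W\<in>vertical_at B X. G X U W)"

text \<open>\<open>F\<^sub>X\<close> is injective, but its image is a proper subspace when the base of \<open>B\<close> has dimension
  less than three; \<open>F\<^sub>X\<^sup>-\<^sup>1\<close> is its inverse on the image, which contains the
  values to which it is applied.\<close>

definition pullback_field ::
  "('m, 'b, 'x::euclidean_space, 'y::euclidean_space) fibre_bundle \<Rightarrow>
   (('m, 'x \<times> 'y) tvec \<Rightarrow> ambient_tvec) \<Rightarrow>
   (vec3 \<times> vec3 \<Rightarrow> euclid_tvec \<Rightarrow> ambient_tvec) \<Rightarrow>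
   'm \<Rightarrow> ('b, 'x) tvec \<Rightarrow> ('m, 'x \<times> 'y) tvec" where
  "pullback_field B F \<sigma> =
     (\<lambda>X\<in>points B. \<lambda>u\<in>tangent_at (base_manifold B) (proj B X).
        inv_into (tangent_at (total_manifold B) X) F
          (\<sigma> (shadow F X) (base_tangent_map B ambient F u)))"

definition pullback_connection ::
  "('m, 'b, 'x::euclidean_space, 'y::euclidean_space) fibre_bundle \<Rightarrow>
   (('m, 'x \<times> 'y) tvec \<Rightarrow> ambient_tvec) \<Rightarrow> 'm \<Rightarrow> ('b, 'x) tvec \<Rightarrow> ('m, 'x \<times> 'y) tvec" where
  "pullback_connection B F = pullback_field B F amb_connection"

definition pullback_solder ::
  "('m, 'b, 'x::euclidean_space, 'y::euclidean_space) fibre_bundle \<Rightarrow>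
   (('m, 'x \<times> 'y) tvec \<Rightarrow> ambient_tvec) \<Rightarrow> 'm \<Rightarrow> ('b, 'x) tvec \<Rightarrow> ('m, 'x \<times> 'y) tvec" where
  "pullback_solder B F = pullback_field B F amb_solder"

end

theory Submission
  imports Defs
begin

text \<open>In trivialising coordinates \<open>F (\<delta>x, \<delta>y) = (J \<delta>x, C \<delta>x + f \<delta>y)\<close>, where \<open>f\<close> is
  invertible because the fibres have the same dimension. Hence
  \<open>\<Gamma> \<delta>x = (\<delta>x, - f\<^sup>-\<^sup>1 C \<delta>x)\<close>, \<open>\<Theta> \<delta>x = (0, f\<^sup>-\<^sup>1 J \<delta>x)\<close>, and \<open>\<GG>\<close> is the pull-back of
  the Euclidean metric along \<open>(\<delta>x, \<delta>y) \<mapsto> (J + C) \<delta>x + f \<delta>y = f (f\<^sup>-\<^sup>1 J \<delta>x + f\<^sup>-\<^sup>1 C \<delta>x + \<delta>y)\<close>,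
  which is determined by the micro-metric \<open>f\<^sup>T f\<close>, \<open>\<Theta>\<close> and \<open>\<Gamma>\<close>. Conversely \<open>\<GG>\<close> yields
  \<open>f\<^sup>T f\<close> and \<open>f\<^sup>T (J + C)\<close>; by micro-linearity \<open>C\<close> vanishes on the zero section, while \<open>J\<close> and \<open>f\<close>
  are constant on the fibre, so that \<open>f\<^sup>T J\<close> and \<open>f\<^sup>T C\<close>, and with them \<open>\<Theta>\<close> and \<open>\<Gamma>\<close>, can be
  separated.\<close>

section \<open>Coordinate representatives and tangent vectors\<close>

lemma Ck_on_Suc_differentiable:
  assumes "Ck_on (Suc k) f S" "x \<in> S"
  shows "f differentiable at x"
  using assms by (auto simp: differentiable_def)

lemma local_deriv_eqI:
  assumes "(local_rep c d f has_derivative D) (at (snd c p))"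
  shows "local_deriv c d f p = D"
  using frechet_derivative_at[OF assms] by (simp add: local_deriv_def)

lemma local_rep_has_derivative:
  assumes "local_rep c d f differentiable at (snd c p)"
  shows "(local_rep c d f has_derivative local_deriv c d f p) (at (snd c p))"
  using assms by (simp add: local_deriv_def frechet_derivative_works)

lemma is_chart_inj_on:
  assumes "is_chart X c"
  shows "inj_on (snd c) (fst c)"
proof -
  have "topspace (subtopology X (fst c)) = fst c"
    using assms by (auto simp: is_chart_def dest: openin_subset)
  then show ?thesis
    using assms homeomorphic_imp_injective_map unfolding is_chart_def by metis
qed

lemma local_rep_apply:
  assumes "is_chart X c" "q \<in> fst c"
  shows "local_rep c d f (snd c q) = snd d (f q)"
  using inv_into_f_f[OF is_chart_inj_on[OF assms(1)] assms(2)] by (simp add: local_rep_def)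

text \<open>The chart is an open map onto an open subset of the model space, so the open set of
  chart points that \<open>f\<close> sends into \<open>fst d\<close> has an open image. This
  openness lets derivatives be compared through identities that hold only near a point.\<close>

lemma open_local_dom:
  assumes c: "is_chart X c" and f: "continuous_map X Y f" and d: "openin Y (fst d)"
  shows "open (local_dom c d f)"
proof -
  have sub: "fst c \<subseteq> topspace X"
    using c by (auto simp: is_chart_def dest: openin_subset)
  have "openin X (fst c \<inter> {p \<in> topspace X. f p \<in> fst d})"
    using c openin_continuous_map_preimage[OF f d] by (auto simp: is_chart_def)
  moreover have "fst c \<inter> {p \<in> topspace X. f p \<in> fst d} = {p \<in> fst c. f p \<in> fst d}"
    using sub by auto
  ultimately have "openin (subtopology X (fst c)) {p \<in> fst c. f p \<in> fst d}"
    by (auto simp: openin_subtopology)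
  moreover have "open_map (subtopology X (fst c)) (top_of_set (snd c ` fst c)) (snd c)"
    using c homeomorphic_imp_open_map by (auto simp: is_chart_def)
  ultimately have "openin (top_of_set (snd c ` fst c)) (snd c ` {p \<in> fst c. f p \<in> fst d})"
    by (auto simp: open_map_def)
  then show ?thesis
    using c openin_open_trans by (auto simp: is_chart_def local_dom_def)
qed

text \<open>\<open>inv_into\<close> is arbitrary off the chart image, so the composite of the local
  representatives is compared with the representative of the composite only on
  \<open>local_dom c d f\<close>. That set is open, which suffices for the chain rule.\<close>

lemma local_deriv_comp:
  assumes c: "is_chart X c" and d: "is_chart Y d" and f: "continuous_map X Y f"
    and p: "p \<in> fst c" "f p \<in> fst d"
    and df: "local_rep c d f differentiable at (snd c p)"
    and dg: "local_rep d e g differentiable at (snd d (f p))"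
  shows "local_deriv c e (g \<circ> f) p = local_deriv d e g (f p) \<circ> local_deriv c d f p"
proof (rule local_deriv_eqI)
  have eq: "local_rep c d f (snd c p) = snd d (f p)"
    using c p(1) by (rule local_rep_apply)
  have "(local_rep d e g \<circ> local_rep c d f has_derivative
      local_deriv d e g (f p) \<circ> local_deriv c d f p) (at (snd c p))"
    using local_rep_has_derivative[OF df] local_rep_has_derivative[OF dg]
    by (intro diff_chain_at) (simp_all add: eq)
  moreover have "open (local_dom c d f)"
    using c f d by (intro open_local_dom[OF c f]) (simp add: is_chart_def)
  moreover have "snd c p \<in> local_dom c d f"
    using p by (auto simp: local_dom_def)
  moreover have "(local_rep d e g \<circ> local_rep c d f) z = local_rep c e (g \<circ> f) z"
    if "z \<in> local_dom c d f" for z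
    using that by (auto simp: local_dom_def local_rep_apply[OF c] local_rep_apply[OF d])
  ultimately show "(local_rep c e (g \<circ> f) has_derivative
      local_deriv d e g (f p) \<circ> local_deriv c d f p) (at (snd c p))"
    by (rule has_derivative_transform_within_open)
qed

lemma manifold_chart:
  assumes "manifold_of_class k M" "c \<in> atlas M"
  shows "is_chart (space_of M) c"
  using assms by (auto simp: manifold_of_class_def)

lemma transition_differentiable:
  assumes "manifold_of_class (Suc k) M" "c \<in> atlas M" "d \<in> atlas M" "p \<in> fst c" "p \<in> fst d"
  shows "local_rep c d id differentiable at (snd c p)"
  using assms
  by (intro Ck_on_Suc_differentiable[of k _ "local_dom c d id"])
    (auto simp: manifold_of_class_def local_dom_def simp del: Ck_on.simps)

lemma smooth_map_differentiable:
  assumes "smooth_map M N f" "c \<in> atlas M" "d \<in> atlas N" "p \<in> fst c" "f p \<in> fst d"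
  shows "local_rep c d f differentiable at (snd c p)"
  using assms
  by (intro Ck_on_Suc_differentiable[of 0 _ "local_dom c d f"])
    (auto simp: smooth_map_def local_dom_def simp del: Ck_on.simps)

lemma transition_linear:
  assumes "manifold_of_class (Suc k) M" "c \<in> atlas M" "d \<in> atlas M" "p \<in> fst c" "p \<in> fst d"
  shows "linear (local_deriv c d id p)"
  using local_rep_has_derivative[OF transition_differentiable[OF assms]]
  by (rule has_derivative_linear)

text \<open>Change of the source chart. For \<open>f = id\<close> it is the cocycle identity behind
  \<open>tvec_of_coords_in\<close>; for general \<open>f\<close> it makes \<open>tangent_map\<close>
  independent of the chart chosen there.\<close>

lemma local_deriv_id_trans:
  assumes "manifold_of_class (Suc k) M" "c \<in> atlas M" "d \<in> atlas M" "p \<in> fst c" "p \<in> fst d"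
    and "local_rep d e f differentiable at (snd d p)"
  shows "local_deriv c e f p w = local_deriv d e f p (local_deriv c d id p w)"
proof -
  have "local_deriv c e (f \<circ> id) p = local_deriv d e f (id p) \<circ> local_deriv c d id p"
    using assms by (intro local_deriv_comp[of "space_of M" _ "space_of M"] transition_differentiable)
      (auto intro: manifold_chart)
  then show ?thesis by simp
qed

lemma local_deriv_same_chart:
  assumes c: "is_chart X c" and p: "p \<in> fst c"
  shows "local_deriv c c id p = id"
proof (rule local_deriv_eqI)
  show "(local_rep c c id has_derivative id) (at (snd c p))"
  proof (rule has_derivative_transform_within_open)
    show "(id has_derivative id) (at (snd c p))" by (simp add: id_def)
    show "open (snd c ` fst c)" using c by (simp add: is_chart_def)
    show "snd c p \<in> snd c ` fst c" using p by simp
    show "id z = local_rep c c id z" if "z \<in> snd c ` fst c" for z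
      using that by (auto simp: local_rep_apply[OF c])
  qed
qed

section \<open>Tangent vectors and tangent maps in one chart\<close>

lemma tangent_at_coords:
  assumes "u \<in> tangent_at M p" "c \<in> atlas M" "p \<in> fst c"
  shows "snd u d = (if d \<in> atlas M \<and> p \<in> fst d then local_deriv c d id p (snd u c) else 0)"
proof -
  have "snd u \<in> tangent_space M p"
    using assms(1) by (auto simp: tangent_at_def)
  then show ?thesis
    using assms(2,3) unfolding tangent_space_def mem_Collect_eq by (metis IntI)
qed

lemma tangent_at_eqI:
  assumes "u \<in> tangent_at M p" "v \<in> tangent_at M p" "c \<in> atlas M" "p \<in> fst c"
    and "snd u c = snd v c"
  shows "u = v"
proof -
  have "snd u d = snd v d" for d
    using tangent_at_coords[OF assms(1,3,4), of d] tangent_at_coords[OF assms(2,3,4), of d] assms(5) by simp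
  moreover have "fst u = fst v"
    using assms by (auto simp: tangent_at_def)
  ultimately show ?thesis by (simp add: prod_eq_iff fun_eq_iff)
qed

lemma snd_tvec_of_coords:
  assumes "manifold_of_class k M" "c \<in> atlas M" "p \<in> fst c"
  shows "snd (tvec_of_coords M c p w) c = w"
  using assms local_deriv_same_chart[OF manifold_chart[OF assms(1,2)]]
  by (simp add: tvec_of_coords_def)

lemma tvec_of_coords_in:
  assumes "manifold_of_class (Suc k) M" "c \<in> atlas M" "p \<in> fst c"
  shows "tvec_of_coords M c p w \<in> tangent_at M p"
  using assms
  by (auto simp: tvec_of_coords_def tangent_at_def tangent_space_def
      intro!: local_deriv_id_trans transition_differentiable)

lemma tvec_of_coords_snd:
  assumes "manifold_of_class (Suc k) M" "c \<in> atlas M" "p \<in> fst c" "u \<in> tangent_at M p"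
  shows "tvec_of_coords M c p (snd u c) = u"
  using assms tvec_of_coords_in[OF assms(1-3)] snd_tvec_of_coords[OF assms(1-3)]
  by (intro tangent_at_eqI[of _ M p _ c]) auto

lemma snd_tvec_of_coords_combination:
  assumes "manifold_of_class (Suc k) M" "c \<in> atlas M" "p \<in> fst c"
  shows "snd (tvec_of_coords M c p (r *\<^sub>R v + s *\<^sub>R w)) =
    (\<lambda>d. r *\<^sub>R snd (tvec_of_coords M c p v) d + s *\<^sub>R snd (tvec_of_coords M c p w) d)"
  using transition_linear[OF assms(1,2) _ assms(3)]
  by (auto simp: tvec_of_coords_def fun_eq_iff linear_add linear_scale)

lemma tangent_map_eq:
  assumes M: "manifold_of_class (Suc k) M" and f: "smooth_map M N f"
    and c: "c \<in> atlas M" "p \<in> fst c" and u: "u \<in> tangent_at M p"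
  shows "tangent_map M N f u =
    (f p, \<lambda>d. if d \<in> atlas N \<and> f p \<in> fst d then local_deriv c d f p (snd u c) else 0)"
proof -
  define c' where "c' = (SOME c. c \<in> atlas M \<and> p \<in> fst c)"
  have c': "c' \<in> atlas M" "p \<in> fst c'"
    using someI[of "\<lambda>c. c \<in> atlas M \<and> p \<in> fst c"] c by (auto simp: c'_def)
  have "local_deriv c' d f p (snd u c') = local_deriv c d f p (snd u c)"
    if d: "d \<in> atlas N" "f p \<in> fst d" for d
  proof -
    have "snd u c' = local_deriv c c' id p (snd u c)"
      using tangent_at_coords[OF u c, of c'] c' by simp
    then show ?thesis
      using local_deriv_id_trans[OF M c(1) c'(1) c(2) c'(2)
          smooth_map_differentiable[OF f c'(1) d(1) c'(2) d(2)]] by simp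
  qed
  moreover have "fst u = p" using u by (auto simp: tangent_at_def)
  ultimately show ?thesis
    by (auto simp: tangent_map_def Let_def c'_def[symmetric])
qed


section \<open>Trivialising coordinates\<close>

lemma total_manifold_simps [simp]:
  "space_of (total_manifold A) = total_space A"
  "atlas (total_manifold A) = total_chart A ` trivs A"
  by (simp_all add: total_manifold_def)

lemma base_manifold_simps [simp]:
  "space_of (base_manifold A) = base_space A"
  "atlas (base_manifold A) = base_chart ` trivs A"
  by (simp_all add: base_manifold_def)

lemma mem_total_chart [simp]: "a \<in> fst (total_chart A t) \<longleftrightarrow> a \<in> points A \<and> proj A a \<in> tdom t"
  by (simp add: total_chart_def)

lemma snd_total_chart [simp]: "snd (total_chart A t) a = (xc t (proj A a), yc t a)"
  by (simp add: total_chart_def)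

lemma base_chart_simps [simp]: "fst (base_chart t) = tdom t" "snd (base_chart t) = xc t"
  by (simp_all add: base_chart_def)

lemma smooth_bundle_manifolds:
  assumes "smooth_bundle A"
  shows "manifold_of_class (Suc 1) (total_manifold A)" "manifold_of_class (Suc 1) (base_manifold A)"
    "smooth_map (total_manifold A) (base_manifold A) (proj A)"
  using assms by (auto simp: smooth_bundle_def numeral_2_eq_2)

lemma exists_triv:
  assumes "smooth_bundle A" "a \<in> points A"
  obtains t where "t \<in> trivs A" "proj A a \<in> tdom t"
proof -
  have "a \<in> (\<Union>c\<in>atlas (total_manifold A). fst c)"
    using assms smooth_bundle_manifolds(1)[OF assms(1)] by (simp add: manifold_of_class_def)
  then show thesis using that by auto
qed

text \<open>The image of a total chart is a full product, so every fibre coordinate is attained;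
  injectivity of the base chart turns equality of base coordinates into equality of base
  points.\<close>

lemma exists_fibre_point:
  assumes A: "smooth_bundle A" and t: "t \<in> trivs A" and x: "x \<in> tdom t"
  obtains a where "a \<in> points A" "proj A a = x" "yc t a = y"
proof -
  have "(xc t x, y) \<in> snd (total_chart A t) ` fst (total_chart A t)"
    using A t x by (auto simp: smooth_bundle_def)
  then obtain a where a: "a \<in> points A" "proj A a \<in> tdom t" "xc t (proj A a) = xc t x" "yc t a = y"
    by auto
  have "is_chart (base_space A) (base_chart t)"
    using manifold_chart[OF smooth_bundle_manifolds(2)[OF A]] t by auto
  from inj_onD[OF is_chart_inj_on[OF this], of "proj A a" x] have "proj A a = x"
    using a x by simp
  then show thesis using that a by auto
qed

lemma fibre_point_unique:
  assumes A: "smooth_bundle A" and t: "t \<in> trivs A" "proj A a \<in> tdom t"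
    and a: "a \<in> points A" "a' \<in> points A" "proj A a' = proj A a" "yc t a' = yc t a"
  shows "a' = a"
proof -
  have "is_chart (total_space A) (total_chart A t)"
    using manifold_chart[OF smooth_bundle_manifolds(1)[OF A]] t by auto
  from inj_onD[OF is_chart_inj_on[OF this], of a' a] show ?thesis
    using a t by simp
qed

lemma local_deriv_proj:
  assumes A: "smooth_bundle A" and t: "t \<in> trivs A" "proj A a \<in> tdom t" and a: "a \<in> points A"
  shows "local_deriv (total_chart A t) (base_chart t) (proj A) a = fst"
    "local_rep (total_chart A t) (base_chart t) (proj A) differentiable at (snd (total_chart A t) a)"
proof -
  have c: "is_chart (total_space A) (total_chart A t)"
    using manifold_chart[OF smooth_bundle_manifolds(1)[OF A]] t by auto
  have "(local_rep (total_chart A t) (base_chart t) (proj A) has_derivative fst)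
      (at (snd (total_chart A t) a))"
  proof (rule has_derivative_transform_within_open)
    show "(fst has_derivative fst) (at (snd (total_chart A t) a))"
      by (intro has_derivative_fst[OF has_derivative_ident, simplified])
    show "open (snd (total_chart A t) ` fst (total_chart A t))"
      using c by (simp add: is_chart_def)
    show "snd (total_chart A t) a \<in> snd (total_chart A t) ` fst (total_chart A t)"
      using a t by (intro imageI) simp
    show "fst z = local_rep (total_chart A t) (base_chart t) (proj A) z"
      if "z \<in> snd (total_chart A t) ` fst (total_chart A t)" for z
      using that local_rep_apply[OF c, where d = "base_chart t" and f = "proj A"] by auto
  qed
  then show "local_deriv (total_chart A t) (base_chart t) (proj A) a = fst"
    "local_rep (total_chart A t) (base_chart t) (proj A) differentiable at (snd (total_chart A t) a)"
    by (auto intro: local_deriv_eqI differentiableI)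
qed

lemma Tproj_eq:
  assumes A: "smooth_bundle A" and t: "t \<in> trivs A" "proj A a \<in> tdom t" and a: "a \<in> points A"
    and u: "u \<in> tangent_at (total_manifold A) a"
  shows "Tproj A u =
    tvec_of_coords (base_manifold A) (base_chart t) (proj A a) (fst (snd u (total_chart A t)))"
proof -
  note M = smooth_bundle_manifolds[OF A]
  have "local_deriv (total_chart A t) e (proj A) a w = local_deriv (base_chart t) e id (proj A a) (fst w)"
    if e: "e \<in> atlas (base_manifold A)" "proj A a \<in> fst e" for e w
  proof -
    \<comment> \<open>Any base chart \<open>e\<close> is reached through the chart of
      \<open>t\<close>: in \<open>id \<circ> proj A\<close> the outer factor becomes the transition
      map and the inner one \<open>fst\<close>.\<close>
    have "local_deriv (total_chart A t) e (id \<circ> proj A) a =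
        local_deriv (base_chart t) e id (proj A a) \<circ>
        local_deriv (total_chart A t) (base_chart t) (proj A) a"
    proof (rule local_deriv_comp)
      show "is_chart (total_space A) (total_chart A t)" "is_chart (base_space A) (base_chart t)"
        using manifold_chart[OF M(1)] manifold_chart[OF M(2)] t by auto
      show "continuous_map (total_space A) (base_space A) (proj A)"
        using M(3) by (simp add: smooth_map_def)
      show "local_rep (total_chart A t) (base_chart t) (proj A) differentiable
          at (snd (total_chart A t) a)"
        by (rule local_deriv_proj(2)[OF A t a])
      show "local_rep (base_chart t) e id differentiable at (snd (base_chart t) (proj A a))"
        using e t by (intro transition_differentiable[OF M(2)]) auto
    qed (use t a in auto)
    then show ?thesis using local_deriv_proj(1)[OF A t a] by simp
  qed
  moreover have "Tproj A u = (proj A a, \<lambda>e. if e \<in> atlas (base_manifold A) \<and> proj A a \<in> fst e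
      then local_deriv (total_chart A t) e (proj A) a (snd u (total_chart A t)) else 0)"
    unfolding Tproj_def using t a by (intro tangent_map_eq[OF M(1) M(3) _ _ u]) simp_all
  ultimately show ?thesis
    by (simp add: tvec_of_coords_def fun_eq_iff)
qed

text \<open>\<open>vertical_at\<close> asks the whole coordinate family of \<open>Tproj A u\<close>
  to vanish; by \<open>Tproj_eq\<close> that family is determined by its member in the chart of
  \<open>t\<close>.\<close>

lemma vertical_at_iff:
  assumes A: "smooth_bundle A" and t: "t \<in> trivs A" "proj A a \<in> tdom t" and a: "a \<in> points A"
  shows "u \<in> vertical_at A a \<longleftrightarrow>
    u \<in> tangent_at (total_manifold A) a \<and> fst (snd u (total_chart A t)) = 0"
proof (cases "u \<in> tangent_at (total_manifold A) a")
  case True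
  note M = smooth_bundle_manifolds(2)[OF A]
  let ?v = "tvec_of_coords (base_manifold A) (base_chart t) (proj A a)"
  have "snd (?v w) (base_chart t) = w" for w
    using t by (intro snd_tvec_of_coords[OF M]) auto
  moreover have "snd (?v 0) = (\<lambda>_. 0)"
    using snd_tvec_of_coords_combination[OF M, of "base_chart t" "proj A a" 0 0 0 0] t by auto
  ultimately have "snd (?v w) = (\<lambda>_. 0) \<longleftrightarrow> w = 0" for w
    by metis
  then show ?thesis
    using True Tproj_eq[OF A t a True] by (simp add: vertical_at_def)
qed (simp add: vertical_at_def)


section \<open>The ambient bundle in canonical coordinates\<close>

lemma ambient_simps [simp]:
  "total_space ambient = euclidean" "base_space ambient = euclidean"
  "proj ambient = fst" "trivs ambient = {canonical}"
  by (simp_all add: ambient_def)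

lemma canonical_simps [simp]: "tdom canonical = UNIV" "xc canonical = id" "yc canonical = snd"
  by (simp_all add: canonical_def)

lemma total_chart_canonical: "total_chart ambient canonical = (UNIV, id)"
  by (simp add: total_chart_def fun_eq_iff)

lemma base_chart_canonical: "base_chart canonical = (UNIV, id)"
  by (simp add: base_chart_def)

lemma local_rep_identity_charts: "local_rep (UNIV, id) (UNIV, id) f = f"
  by (simp add: local_rep_def inv_id[unfolded id_def] fun_eq_iff id_def)

lemma local_deriv_identity_charts:
  assumes "bounded_linear f"
  shows "local_deriv (UNIV, id) (UNIV, id) f p = f"
  using bounded_linear_imp_has_derivative[OF assms]
  by (intro local_deriv_eqI) (simp add: local_rep_identity_charts)

lemma local_deriv_identity_charts_id [simp]: "local_deriv (UNIV, id) (UNIV, id) id p = id"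
  by (rule local_deriv_identity_charts) (simp add: id_def bounded_linear_ident)

lemma ambient_coords_ambient_vec [simp]: "ambient_coords (ambient_vec p w) = w"
  by (simp add: ambient_coords_def ambient_vec_def tvec_of_coords_def total_chart_canonical)

lemma fst_ambient_vec [simp]: "fst (ambient_vec p w) = p"
  by (simp add: ambient_vec_def tvec_of_coords_def)

lemma ambient_vec_ambient_coords:
  assumes "V \<in> tangent_at (total_manifold ambient) p"
  shows "ambient_vec p (ambient_coords V) = V"
proof -
  \<comment> \<open>The ambient atlas has a single chart, and the encoding of tangent vectors fixes
    the value 0 everywhere else.\<close>
  have "snd V d = 0" if "d \<noteq> (UNIV, id)" for d
    using assms that
    by (cases d) (simp add: tangent_at_def tangent_space_def total_chart_canonical mem_Times_iff)
  then have "snd (ambient_vec p (ambient_coords V)) d = snd V d" for d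
    by (simp add: ambient_coords_def ambient_vec_def tvec_of_coords_def total_chart_canonical)
  moreover have "fst V = p" using assms by (auto simp: tangent_at_def)
  ultimately show ?thesis by (simp add: prod_eq_iff fun_eq_iff)
qed

lemma euclid_coords_euclid_vec [simp]: "euclid_coords (euclid_vec p w) = w"
  by (simp add: euclid_coords_def euclid_vec_def tvec_of_coords_def base_chart_canonical)

lemma euclid_coords_Tproj: "euclid_coords (Tproj ambient V) = fst (ambient_coords V)"
proof -
  have some: "(SOME c. c \<in> atlas (total_manifold ambient) \<and> fst V \<in> fst c) = (UNIV, id)"
    by (rule some_equality) (auto simp: total_chart_canonical)
  show ?thesis
    unfolding Tproj_def tangent_map_def some Let_def
    by (simp add: euclid_coords_def ambient_coords_def
        base_chart_canonical total_chart_canonical local_deriv_identity_charts bounded_linear_fst)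
qed

text \<open>\<open>amb_iota\<close> adds horizontal and vertical components, so the metric sees only
  their sum. This is why micro-linearity is called upon later to separate the two.\<close>

lemma amb_metric_ambient_vec:
  "amb_metric (ambient_vec p v) (ambient_vec q w) = (fst v + snd v) \<bullet> (fst w + snd w)"
  by (simp add: amb_metric_def euclid_metric_def amb_iota_def)


section \<open>Micro-linear maps in coordinates\<close>

text \<open>The slice \<open>i\<close> parametrises the whole fibre, and along it the local
  representative is exactly \<open>g\<close>; the chain rule and uniqueness of derivatives
  conclude.\<close>

lemma local_deriv_along_fibre:
  fixes A :: "('m, 'b, 'x::euclidean_space, 'y::euclidean_space) fibre_bundle"
  assumes A: "smooth_bundle A" and t: "t \<in> trivs A" "proj A a \<in> tdom t" and a: "a \<in> points A"
    and f: "local_rep (total_chart A t) d f differentiable at (snd (total_chart A t) a)"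
    and g: "\<And>b. b \<in> points A \<Longrightarrow> proj A b = proj A a \<Longrightarrow> snd d (f b) = g (yc t b)"
      "(g has_derivative g') (at (yc t a))"
  shows "local_deriv (total_chart A t) d f a (0, v) = g' v"
proof -
  define i :: "'y \<Rightarrow> 'x \<times> 'y" where "i = (\<lambda>y. (xc t (proj A a), y))"
  have c: "is_chart (total_space A) (total_chart A t)"
    using manifold_chart[OF smooth_bundle_manifolds(1)[OF A]] t by auto
  have eq: "local_rep (total_chart A t) d f \<circ> i = g"
  proof
    fix y
    obtain b where b: "b \<in> points A" "proj A b = proj A a" "yc t b = y"
      using exists_fibre_point[OF A t] by metis
    then have "i y = snd (total_chart A t) b" by (simp add: i_def)
    then show "(local_rep (total_chart A t) d f \<circ> i) y = g y"
      using local_rep_apply[OF c, of b d f] b t g(1) by simp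
  qed
  have "(i has_derivative (\<lambda>v. (0, v))) (at (yc t a))"
    unfolding i_def by (auto intro!: derivative_eq_intros)
  moreover have "(local_rep (total_chart A t) d f has_derivative local_deriv (total_chart A t) d f a)
      (at (i (yc t a)))"
    using local_rep_has_derivative[OF f] by (simp add: i_def)
  ultimately have "(local_rep (total_chart A t) d f \<circ> i has_derivative
      local_deriv (total_chart A t) d f a \<circ> (\<lambda>v. (0, v))) (at (yc t a))"
    by (rule diff_chain_at)
  then have "local_deriv (total_chart A t) d f a \<circ> (\<lambda>v. (0, v)) = g'"
    using has_derivative_unique[OF _ g(2)] unfolding eq by blast
  then show ?thesis by (auto simp: fun_eq_iff)
qed

lemma tangent_vectorsI:
  assumes "u \<in> tangent_at M p" "p \<in> topspace (space_of M)"
  shows "u \<in> tangent_vectors M"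
  using assms by (auto simp: tangent_vectors_def)

text \<open>The carrier of a generated topology is the union of its generators, and
  \<open>W = UNIV\<close> covers all vectors over a chart. An embedding gives injectivity on this
  carrier, hence the inclusion.\<close>

lemma tangent_vectors_subset:
  assumes "smooth_bundle A"
  shows "tangent_vectors (total_manifold A) \<subseteq> topspace (space_of (TT A))"
proof
  fix u assume u: "u \<in> tangent_vectors (total_manifold A)"
  then have "fst u \<in> points A" by (auto simp: tangent_vectors_def tangent_at_def)
  then obtain t where t: "t \<in> trivs A" "proj A (fst u) \<in> tdom t"
    using exists_triv[OF assms] by blast
  let ?c = "tangent_chart (total_manifold A) (total_chart A t)"
  have "u \<in> {v \<in> fst ?c. snd ?c v \<in> UNIV}"
    using u t \<open>fst u \<in> points A\<close> by (simp add: tangent_chart_def)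
  moreover have "{v \<in> fst ?c. snd ?c v \<in> UNIV} \<in>
      {{v \<in> fst (tangent_chart (total_manifold A) c). snd (tangent_chart (total_manifold A) c) v \<in> W} | c W.
        c \<in> atlas (total_manifold A) \<and> open W}"
    using t open_UNIV by (simp only: mem_Collect_eq total_manifold_simps) blast
  ultimately show "u \<in> topspace (space_of (TT A))"
    unfolding tangent_manifold_def manifold.simps topology_generated_by_topspace by blast
qed

lemma Conf_inj_on:
  assumes "smooth_bundle A" "F \<in> Conf A D" "a \<in> points A"
  shows "inj_on F (tangent_at (total_manifold A) a)"
proof -
  have "embedding_map (space_of (TT A)) (space_of (TT D)) F"
    using assms(2) by (simp add: Conf_def diff_embedding_def)
  then have "inj_on F (topspace (space_of (TT A)))"
    unfolding embedding_map_def by (rule homeomorphic_imp_injective_map)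
  moreover have "tangent_at (total_manifold A) a \<subseteq> tangent_vectors (total_manifold A)"
    using assms(3) by (auto simp: tangent_vectors_def)
  ultimately show ?thesis
    using tangent_vectors_subset[OF assms(1)] by (meson inj_on_subset subset_trans)
qed

lemma linear_inj_imp_bij_of_DIM_eq:
  fixes f :: "'a::euclidean_space \<Rightarrow> 'b::euclidean_space"
  assumes "linear f" "inj f" "DIM('a) = DIM('b)"
  shows "bij f"
proof -
  have "dim (range f) = DIM('b)"
    using assms dim_image_eq[of f UNIV] by simp
  then have "span (range f) = UNIV" by (simp add: dim_eq_full)
  then have "range f = UNIV"
    using linear_span_image[OF assms(1), of UNIV] by simp
  then show ?thesis using assms(2) by (simp add: bij_def)
qed

text \<open>In a trivialisation \<open>t\<close>, over a base point \<open>x\<close>, a micro-linear \<open>F\<close> reads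
  \<open>(\<delta>x, \<delta>y) \<mapsto> (J \<delta>x, C y \<delta>x + f \<delta>y)\<close>. The block \<open>f\<close> is the same at all
  points \<open>y\<close> of the fibre.\<close>

definition coordinate_blocks ::
  "('m, 'b, 'x::euclidean_space, 'y::euclidean_space) fibre_bundle \<Rightarrow>
   (('m, 'x \<times> 'y) tvec \<Rightarrow> ambient_tvec) \<Rightarrow> ('m, 'b, 'x, 'y) trivialisation \<Rightarrow> 'b \<Rightarrow>
   ('x \<Rightarrow> vec3) \<Rightarrow> ('y \<Rightarrow> vec3) \<Rightarrow> ('y \<Rightarrow> 'x \<Rightarrow> vec3) \<Rightarrow> bool" where
  "coordinate_blocks B F t x J f C \<longleftrightarrow>
     linear f \<and> bij f \<and> J 0 = 0 \<and> (\<forall>y. C y 0 = 0) \<and> (\<forall>\<delta>. C 0 \<delta> = 0) \<and>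
     (\<forall>a\<in>points B. proj B a = x \<longrightarrow> (\<forall>\<delta> \<eta>.
        F (tvec_of_coords (total_manifold B) (total_chart B t) a (\<delta>, \<eta>)) =
          ambient_vec (shadow F a) (J \<delta>, C (yc t a) \<delta> + f \<eta>))) \<and>
     (\<forall>\<delta>. euclid_coords (base_tangent_map B ambient F
        (tvec_of_coords (base_manifold B) (base_chart t) x \<delta>)) = J \<delta>)"

text \<open>Compatibility with the projections yields \<open>J\<close>; the tangent map of the
  shadow on vertical vectors yields \<open>f\<close>; injectivity of \<open>F\<close> makes
  \<open>f\<close> injective; micro-linearity makes \<open>f\<close> linear and \<open>C 0\<close>
  vanish.\<close>

lemma Conf_lin_coords:
  fixes B :: "('m, 'b, 'x::euclidean_space, 'y::euclidean_space) fibre_bundle"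
    and F :: "('m, 'x \<times> 'y) tvec \<Rightarrow> ambient_tvec"
  assumes B: "smooth_bundle B" and dim: "DIM('y) = 3" and F: "F \<in> Conf_lin B ambient"
    and t: "t \<in> trivs B" and x: "x \<in> tdom t"
  obtains J f C where "coordinate_blocks B F t x J f C"
proof -
  note M = smooth_bundle_manifolds[OF B]
  let ?c = "total_chart B t"
  define v where "v = tvec_of_coords (total_manifold B) ?c"
  define k where "k = (\<lambda>a w. ambient_coords (F (v a w)))"
  \<comment> \<open>Defined from the base map alone, \<open>J\<close> is the same at all points of
    the fibre.\<close>
  define J where "J = (\<lambda>\<delta>. euclid_coords
    (base_tangent_map B ambient F (tvec_of_coords (base_manifold B) (base_chart t) x \<delta>)))"
  have pa: "F \<in> phys_acceptable B ambient" and ml: "micro_linear B ambient F"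
    and Fc: "F \<in> Conf B ambient"
    using F by (auto simp: Conf_lin_def Conf_def)
  have shadow: "smooth_map (total_manifold B) (total_manifold ambient) (shadow F)"
    "\<And>a. a \<in> points B \<Longrightarrow> fst (shadow F a) = base_map B ambient (shadow F) (proj B a)"
    using pa by (auto simp: phys_acceptable_def Aff_def)
  have vb: "vb_morphism_over (total_manifold B) (total_manifold ambient) (shadow F) F"
    using pa by (simp add: phys_acceptable_def)
  \<comment> \<open>One linear map serves the whole fibre over \<open>x\<close>. Being its own
    derivative, it is also the vertical block of \<open>F\<close> at each point of that
    fibre.\<close>
  obtain f where f: "linear f"
      "\<And>a. a \<in> points B \<Longrightarrow> proj B a = x \<Longrightarrow> snd (shadow F a) = f (yc t a)"
    using ml t x unfolding micro_linear_def by fastforce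
  have v: "v a w \<in> tangent_at (total_manifold B) a" "snd (v a w) ?c = w" "fst (v a w) = a"
    if "a \<in> points B" "proj B a = x" for a w
  proof -
    show "v a w \<in> tangent_at (total_manifold B) a"
      unfolding v_def using that t x by (intro tvec_of_coords_in[OF M(1)]) auto
    show "snd (v a w) ?c = w"
      unfolding v_def using that t x by (intro snd_tvec_of_coords[OF M(1)]) auto
    show "fst (v a w) = a" by (simp add: v_def tvec_of_coords_def)
  qed
  have k_lin: "k a (r *\<^sub>R w + s *\<^sub>R w') = r *\<^sub>R k a w + s *\<^sub>R k a w'"
    if a: "a \<in> points B" "proj B a = x" for a r s w w'
  proof -
    have "snd (v a (r *\<^sub>R w + s *\<^sub>R w')) = (\<lambda>c. r *\<^sub>R snd (v a w) c + s *\<^sub>R snd (v a w') c)"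
      unfolding v_def using a t x by (intro snd_tvec_of_coords_combination[OF M(1)]) auto
    then have eq: "v a (r *\<^sub>R w + s *\<^sub>R w') = (a, \<lambda>c. r *\<^sub>R snd (v a w) c + s *\<^sub>R snd (v a w') c)"
      using v(3)[OF a] by (simp add: prod_eq_iff)
    have mem: "snd (v a w) \<in> tangent_space (total_manifold B) a" for w
      using v(1)[OF a, of w] by (auto simp: tangent_at_def)
    have pair: "(a, snd (v a w)) = v a w" for w
      using v(3)[OF a] by (simp add: prod_eq_iff)
    have "snd (F (v a (r *\<^sub>R w + s *\<^sub>R w'))) =
        (\<lambda>d. r *\<^sub>R snd (F (v a w)) d + s *\<^sub>R snd (F (v a w')) d)"
      using vb a mem[of w] mem[of w'] unfolding eq vb_morphism_over_def
      by (simp add: pair)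
    then show ?thesis by (simp add: k_def ambient_coords_def)
  qed
  have k_fst: "fst (k a w) = J (fst w)" if a: "a \<in> points B" "proj B a = x" for a w
  proof -
    have "fst (k a w) = euclid_coords (Tproj ambient (F (v a w)))"
      by (simp add: k_def euclid_coords_Tproj)
    also have "Tproj ambient (F (v a w)) = base_tangent_map B ambient F (Tproj B (v a w))"
      using pa tangent_vectorsI[OF v(1)[OF a, of w]] a by (simp add: phys_acceptable_def)
    also have "Tproj B (v a w) = tvec_of_coords (base_manifold B) (base_chart t) x (fst w)"
      using Tproj_eq[OF B t _ a(1) v(1)[OF a, of w]] a x v(2)[OF a] by simp
    finally show ?thesis by (simp add: J_def)
  qed
  have k_vertical: "k a (0, \<delta>) = (0, f \<delta>)" if a: "a \<in> points B" "proj B a = x" for a \<delta>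
  proof -
    have ta: "proj B a \<in> tdom t" using a x by simp
    have ca: "?c \<in> atlas (total_manifold B)" "a \<in> fst ?c" using a t ta by auto
    have cA: "total_chart ambient canonical \<in> atlas (total_manifold ambient)"
      "shadow F a \<in> fst (total_chart ambient canonical)"
      by (simp_all add: total_chart_canonical)
    have "v a (0, \<delta>) \<in> vertical_at B a"
      using vertical_at_iff[OF B t ta a(1)] v[OF a] by simp
    then have "F (v a (0, \<delta>)) =
        tangent_map (total_manifold B) (total_manifold ambient) (shadow F) (v a (0, \<delta>))"
      using pa a by (simp add: phys_acceptable_def)
    then have "k a (0, \<delta>) = local_deriv ?c (total_chart ambient canonical) (shadow F) a (0, \<delta>)"
      using tangent_map_eq[OF M(1) shadow(1) ca v(1)[OF a]] cA v(2)[OF a]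
      by (simp add: k_def ambient_coords_def)
    also have "\<dots> = (0, f \<delta>)"
    proof (rule local_deriv_along_fibre[OF B t ta a(1)])
      show "local_rep ?c (total_chart ambient canonical) (shadow F) differentiable at (snd ?c a)"
        by (rule smooth_map_differentiable[OF shadow(1) ca(1) cA(1) ca(2) cA(2)])
      show "snd (total_chart ambient canonical) (shadow F b) =
          (base_map B ambient (shadow F) x, f (yc t b))"
        if "b \<in> points B" "proj B b = proj B a" for b
        using that a shadow(2)[of b] f(2)[of b] by simp
      show "((\<lambda>y. (base_map B ambient (shadow F) x, f y)) has_derivative (\<lambda>v. (0, f v)))
          (at (yc t a))"
        using f(1) by (intro has_derivative_Pair has_derivative_const linear_imp_has_derivative)
    qed
    finally show ?thesis .
  qed
  \<comment> \<open>The coupling block is to be a function of the fibre coordinate, so a point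
    \<open>pt y\<close> is picked for each \<open>y\<close>; \<open>pt_yc\<close> shows that it is
    the only one.\<close>
  have "\<forall>y. \<exists>a. a \<in> points B \<and> proj B a = x \<and> yc t a = y"
    using exists_fibre_point[OF B t x] by blast
  then obtain pt where pt: "\<And>y. pt y \<in> points B \<and> proj B (pt y) = x \<and> yc t (pt y) = y"
    unfolding choice_iff by blast
  have pt_yc: "pt (yc t a) = a" if "a \<in> points B" "proj B a = x" for a
    using fibre_point_unique[OF B t, of a "pt (yc t a)"] pt[of "yc t a"] that x by simp
  define C where "C = (\<lambda>y \<delta>. snd (k (pt y) (\<delta>, 0)))"
  have k_eq: "k a w = (J (fst w), C (yc t a) (fst w) + f (snd w))"
    if a: "a \<in> points B" "proj B a = x" for a w
  proof -
    have "k a w = k a (fst w, 0) + k a (0, snd w)"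
      using k_lin[OF a, of 1 "(fst w, 0)" 1 "(0, snd w)"] by simp
    then show ?thesis
      using k_vertical[OF a] k_fst[OF a, of w] pt_yc[OF a] by (simp add: C_def prod_eq_iff)
  qed
  have k0: "k a 0 = 0" if "a \<in> points B" "proj B a = x" for a
    using k_lin[OF that, of 0 0 0 0] by simp
  have F_eq: "F (v a w) = ambient_vec (shadow F a) (k a w)"
    if a: "a \<in> points B" "proj B a = x" for a w
  proof -
    have "F (v a w) \<in> tangent_at (total_manifold ambient) (shadow F a)"
      using vb a v(1)[OF a] by (simp add: vb_morphism_over_def)
    then show ?thesis
      by (simp add: k_def ambient_vec_ambient_coords)
  qed
  have inj: "inj f"
  proof (rule injI)
    fix y y' assume eq: "f y = f y'"
    have a: "pt 0 \<in> points B" "proj B (pt 0) = x" using pt by auto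
    have "F (v (pt 0) (0, y)) = F (v (pt 0) (0, y'))"
      by (simp add: F_eq[OF a] k_vertical[OF a] eq)
    then have "v (pt 0) (0, y) = v (pt 0) (0, y')"
      by (rule inj_onD[OF Conf_inj_on[OF B Fc a(1)] _ v(1)[OF a] v(1)[OF a]])
    from arg_cong[OF this, of "\<lambda>u. snd u ?c"] show "y = y'"
      by (simp only: v(2)[OF a] prod.inject)
  qed
  have C0: "C 0 \<delta> = 0" for \<delta>
  proof -
    \<comment> \<open>\<open>g\<close> depends only on \<open>x\<close> and \<open>\<delta>\<close>,
      so it may be evaluated at the point with fibre coordinate 0, where linearity gives 0.\<close>
    obtain g where g: "linear g" "\<And>u. u \<in> tangent_vectors (total_manifold B) \<Longrightarrow>
        proj B (fst u) = x \<Longrightarrow> snd u ?c = (\<delta>, 0) \<Longrightarrow> snd (ambient_coords (F u)) = g (yc t (fst u))"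
      using ml t x unfolding micro_linear_def ambient_coords_def by fastforce
    have a: "pt 0 \<in> points B" "proj B (pt 0) = x" using pt by auto
    have "C 0 \<delta> = g (yc t (fst (v (pt 0) (\<delta>, 0))))"
      unfolding C_def k_def using v[OF a] a by (intro g(2) tangent_vectorsI[OF v(1)[OF a]]) simp_all
    then show ?thesis using v(3)[OF a] pt g(1) by (simp add: linear_0)
  qed
  \<comment> \<open>The rank of the material bundle equals the dimension of the ambient
    fibre.\<close>
  have "bij f" using f(1) inj dim by (intro linear_inj_imp_bij_of_DIM_eq) simp_all
  moreover have "J 0 = 0" using k_fst[of "pt 0" 0] k0 pt by simp
  moreover have "C y 0 = 0" for y using k0[of "pt y"] pt by (simp add: C_def zero_prod_def)
  moreover have "F (v a (\<delta>, \<eta>)) = ambient_vec (shadow F a) (J \<delta>, C (yc t a) \<delta> + f \<eta>)"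
    if "a \<in> points B" "proj B a = x" for a \<delta> \<eta>
    using F_eq[OF that] k_eq[OF that] by simp
  ultimately have "coordinate_blocks B F t x J f C"
    using f(1) C0 by (simp add: coordinate_blocks_def v_def J_def)
  then show thesis by (rule that)
qed

section \<open>Pull-backs in coordinates\<close>

lemma pullback_metric_coords:
  fixes a B t
  defines "v \<equiv> tvec_of_coords (total_manifold B) (total_chart B t) a"
  assumes B: "smooth_bundle B" and F: "coordinate_blocks B F t x J f C"
    and t: "t \<in> trivs B" "x \<in> tdom t" and a: "a \<in> points B" "proj B a = x"
  shows "pullback_metric B F a (v (\<delta>, \<eta>)) (v (\<delta>', \<eta>')) =
    (J \<delta> + C (yc t a) \<delta> + f \<eta>) \<bullet> (J \<delta>' + C (yc t a) \<delta>' + f \<eta>')"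
proof -
  have "v w \<in> tangent_at (total_manifold B) a" for w
    unfolding v_def using t a by (intro tvec_of_coords_in[OF smooth_bundle_manifolds(1)[OF B]]) simp_all
  moreover have "F (v (\<delta>, \<eta>)) = ambient_vec (shadow F a) (J \<delta>, C (yc t a) \<delta> + f \<eta>)" for \<delta> \<eta>
    using F a by (simp add: coordinate_blocks_def v_def)
  ultimately show ?thesis
    using a by (simp add: pullback_metric_def amb_metric_ambient_vec add.assoc)
qed

text \<open>\<open>F\<close> is injective on the tangent space, so exhibiting one preimage computes
  \<open>inv_into\<close> and shows at the same time that the value lies in the image.\<close>

lemma pullback_field_eq:
  assumes B: "smooth_bundle B" and F: "F \<in> Conf B ambient" and a: "a \<in> points B"
    and u: "u \<in> tangent_at (base_manifold B) (proj B a)"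
    and U: "U \<in> tangent_at (total_manifold B) a"
      "F U = \<sigma> (shadow F a) (base_tangent_map B ambient F u)"
  shows "pullback_field B F \<sigma> a u = U"
  using inv_into_f_f[OF Conf_inj_on[OF B F a] U(1)] a u U(2) by (simp add: pullback_field_def)

text \<open>The right-hand sides solve
  \<open>(J \<xi>, C \<xi> + f \<eta>) = (J \<delta>, 0)\<close> with
  \<open>\<xi> = \<delta>\<close>, and
  \<open>(J \<xi>, C \<xi> + f \<eta>) = (0, J \<delta>)\<close> with
  \<open>\<xi> = 0\<close>.\<close>

lemma pullback_fields_coords:
  fixes a B t
  defines "v \<equiv> tvec_of_coords (total_manifold B) (total_chart B t) a"
    and "u \<equiv> tvec_of_coords (base_manifold B) (base_chart t) (proj B a)"
  assumes B: "smooth_bundle B" and FC: "F \<in> Conf B ambient"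
    and F: "coordinate_blocks B F t (proj B a) J f C"
    and t: "t \<in> trivs B" "proj B a \<in> tdom t" and a: "a \<in> points B"
  shows "pullback_connection B F a (u \<delta>) = v (\<delta>, - inv f (C (yc t a) \<delta>))"
    and "pullback_solder B F a (u \<delta>) = v (0, inv f (J \<delta>))"
proof -
  have v: "v w \<in> tangent_at (total_manifold B) a" for w
    unfolding v_def using t a by (intro tvec_of_coords_in[OF smooth_bundle_manifolds(1)[OF B]]) simp_all
  have u: "u \<delta> \<in> tangent_at (base_manifold B) (proj B a)"
    unfolding u_def using t by (intro tvec_of_coords_in[OF smooth_bundle_manifolds(2)[OF B]]) simp_all
  have Fv: "F (v (\<delta>, \<eta>)) = ambient_vec (shadow F a) (J \<delta>, C (yc t a) \<delta> + f \<eta>)" for \<delta> \<eta>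
    using F a by (simp add: coordinate_blocks_def v_def)
  have J: "euclid_coords (base_tangent_map B ambient F (u \<delta>)) = J \<delta>"
    using F by (simp add: coordinate_blocks_def u_def)
  have f: "f (inv f z) = z" "f (- w) = - f w" "J 0 = 0" "C y 0 = 0" for z w y
    using F by (simp_all add: coordinate_blocks_def bij_is_surj surj_f_inv_f linear_neg)
  show "pullback_connection B F a (u \<delta>) = v (\<delta>, - inv f (C (yc t a) \<delta>))"
    unfolding pullback_connection_def
    by (rule pullback_field_eq[OF B FC a u v]) (simp add: amb_connection_def Fv J f)
  show "pullback_solder B F a (u \<delta>) = v (0, inv f (J \<delta>))"
    unfolding pullback_solder_def
    by (rule pullback_field_eq[OF B FC a u v]) (simp add: amb_solder_def Fv J f)
qed

section \<open>Comparison of two configurations\<close>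

lemma bundle_fields_eqI:
  assumes B: "smooth_bundle B"
    and eq: "\<And>t a. \<lbrakk>t \<in> trivs B; proj B a \<in> tdom t; a \<in> points B\<rbrakk> \<Longrightarrow> \<phi> a = \<phi>' a"
  shows "(\<lambda>a\<in>points B. \<phi> a) = (\<lambda>a\<in>points B. \<phi>' a)"
  using exists_triv[OF B] eq by (intro restrict_ext) metis

text \<open>The isometry \<open>f v \<mapsto> f' v\<close> is onto, and \<open>z\<close>, \<open>z'\<close> have the same inner products with
  corresponding vectors, so it maps \<open>z\<close> to \<open>z'\<close>.\<close>

lemma inv_eq_of_inner_eq:
  fixes f f' :: "'a \<Rightarrow> 'v::real_inner"
  assumes "bij f" "bij f'" and "\<And>v w. f v \<bullet> f w = f' v \<bullet> f' w" and "\<And>v. f v \<bullet> z = f' v \<bullet> z'"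
  shows "inv f z = inv f' z'"
proof -
  define p where "p = inv f z"
  have z: "f p = z" using assms(1) by (simp add: p_def bij_is_surj surj_f_inv_f)
  have ortho: "f' v \<bullet> (z' - f' p) = 0" for v
    using assms(3)[of v p] assms(4)[of v] z by (simp add: inner_diff_right)
  obtain v where "f' v = z' - f' p" using assms(2) by (metis bij_pointE)
  then have "z' = f' p" using ortho[of v] by simp
  then show ?thesis using assms(2) by (simp add: p_def bij_is_inj)
qed

theorem mainTheorem5:
  fixes B :: "('m, 'b, 'x::euclidean_space, 'y::euclidean_space) fibre_bundle"
    and F F' :: "('m, 'x \<times> 'y) tvec \<Rightarrow> ambient_tvec"
  assumes "material_bundle B" and "vector_bundle B"
    and "F \<in> Conf_lin B ambient" and "F' \<in> Conf_lin B ambient"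
  shows "pullback_metric B F = pullback_metric B F' \<longleftrightarrow>
    micro_metric B (pullback_metric B F) = micro_metric B (pullback_metric B F') \<and>
    pullback_connection B F = pullback_connection B F' \<and>
    pullback_solder B F = pullback_solder B F'"
proof -
  have B: "smooth_bundle B" and dim: "DIM('y) = 3"
    using assms(1,2) by (auto simp: material_bundle_def vector_bundle_def)
  note M = smooth_bundle_manifolds[OF B]
  have Conf: "F \<in> Conf B ambient" "F' \<in> Conf B ambient"
    using assms(3,4) by (auto simp: Conf_lin_def)
  have fields: "pullback_connection B F a u = pullback_connection B F' a u \<and>
      pullback_solder B F a u = pullback_solder B F' a u"
    if G: "pullback_metric B F = pullback_metric B F'" and t: "t \<in> trivs B" "proj B a \<in> tdom t"
      and a: "a \<in> points B" and u: "u \<in> tangent_at (base_manifold B) (proj B a)" for t a u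
  proof -
    obtain J f C where c: "coordinate_blocks B F t (proj B a) J f C"
      using Conf_lin_coords[OF B dim assms(3) t] .
    obtain J' f' C' where c': "coordinate_blocks B F' t (proj B a) J' f' C'"
      using Conf_lin_coords[OF B dim assms(4) t] .
    have zero: "J 0 = 0" "J' 0 = 0" "C y 0 = 0" "C' y 0 = 0" "C 0 \<delta> = 0" "C' 0 \<delta> = 0"
      "f 0 = 0" "f' 0 = 0" for y \<delta>
      using c c' by (simp_all add: coordinate_blocks_def linear_0)
    have bij: "bij f" "bij f'"
      using c c' by (simp_all add: coordinate_blocks_def)
    have G_eq: "(J \<delta> + C (yc t b) \<delta> + f \<eta>) \<bullet> (J \<delta>' + C (yc t b) \<delta>' + f \<eta>') =
        (J' \<delta> + C' (yc t b) \<delta> + f' \<eta>) \<bullet> (J' \<delta>' + C' (yc t b) \<delta>' + f' \<eta>')"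
      if "b \<in> points B" "proj B b = proj B a" for b \<delta> \<eta> \<delta>' \<eta>'
      using pullback_metric_coords[OF B c t that] pullback_metric_coords[OF B c' t that] G by metis
    have ff: "f \<eta> \<bullet> f \<eta>' = f' \<eta> \<bullet> f' \<eta>'" for \<eta> \<eta>'
      using G_eq[OF a refl, of 0 \<eta> 0 \<eta>'] by (simp add: zero)
    \<comment> \<open>On the zero section \<open>C\<close> and \<open>C'\<close> vanish, so the
      mixed products there isolate \<open>J\<close>. The blocks \<open>J\<close> and
      \<open>f\<close> being constant on the fibre, \<open>fJ\<close> can be used at
      \<open>a\<close> too.\<close>
    obtain a0 where a0: "a0 \<in> points B" "proj B a0 = proj B a" "yc t a0 = 0"
      using exists_fibre_point[OF B t] by blast
    have fJ: "f \<eta> \<bullet> J \<delta> = f' \<eta> \<bullet> J' \<delta>" for \<eta> \<delta>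
      using G_eq[OF a0(1,2), of 0 \<eta> \<delta> 0] by (simp add: zero a0(3))
    \<comment> \<open>The mixed products at \<open>a\<close> involve \<open>J + C\<close>; the part
      known from \<open>fJ\<close> is subtracted.\<close>
    have fC: "f \<eta> \<bullet> C (yc t a) \<delta> = f' \<eta> \<bullet> C' (yc t a) \<delta>" for \<eta> \<delta>
      using G_eq[OF a refl, of 0 \<eta> \<delta> 0] fJ[of \<eta> \<delta>] by (simp add: zero inner_add_right)
    have "u = tvec_of_coords (base_manifold B) (base_chart t) (proj B a) (snd u (base_chart t))"
      using t by (intro tvec_of_coords_snd[OF M(2) _ _ u, symmetric]) simp_all
    then show ?thesis
      using pullback_fields_coords[OF B Conf(1) c t a] pullback_fields_coords[OF B Conf(2) c' t a]
        inv_eq_of_inner_eq[OF bij ff fJ] inv_eq_of_inner_eq[OF bij ff fC] by metis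
  qed
  have metric: "pullback_metric B F a u w = pullback_metric B F' a u w"
    if mic: "micro_metric B (pullback_metric B F) = micro_metric B (pullback_metric B F')"
      and conn: "pullback_connection B F = pullback_connection B F'"
      and sold: "pullback_solder B F = pullback_solder B F'"
      and t: "t \<in> trivs B" "proj B a \<in> tdom t" and a: "a \<in> points B"
      and uw: "u \<in> tangent_at (total_manifold B) a" "w \<in> tangent_at (total_manifold B) a" for t a u w
  proof -
    let ?v = "tvec_of_coords (total_manifold B) (total_chart B t) a"
    have v: "?v w \<in> tangent_at (total_manifold B) a" "snd (?v w) (total_chart B t) = w" for w
      using t a by (intro tvec_of_coords_in[OF M(1)] snd_tvec_of_coords[OF M(1)]; simp)+
    have v_inj: "w = w'" if "?v w = ?v w'" for w w'
      using arg_cong[OF that, of "\<lambda>u. snd u (total_chart B t)"] by (simp only: v(2))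
    obtain J f C where c: "coordinate_blocks B F t (proj B a) J f C"
      using Conf_lin_coords[OF B dim assms(3) t] .
    obtain J' f' C' where c': "coordinate_blocks B F' t (proj B a) J' f' C'"
      using Conf_lin_coords[OF B dim assms(4) t] .
    have zero: "J 0 = 0" "J' 0 = 0" "C y 0 = 0" "C' y 0 = 0" for y
      using c c' by (simp_all add: coordinate_blocks_def)
    have lin: "linear f" "linear f'" and bij: "bij f" "bij f'"
      using c c' by (simp_all add: coordinate_blocks_def)
    \<comment> \<open>\<open>p\<close> is the vertical part of the solder form of \<open>F\<close>,
      and \<open>q\<close> minus that of its connection. By \<open>p'\<close> and \<open>q'\<close>
      they are the same for \<open>F'\<close>.\<close>
    define p q where "p = (\<lambda>\<delta>. inv f (J \<delta>))" and "q = (\<lambda>\<delta>. inv f (C (yc t a) \<delta>))"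
    have "?v (\<delta>, - inv f (C (yc t a) \<delta>)) = ?v (\<delta>, - inv f' (C' (yc t a) \<delta>))" for \<delta>
      using pullback_fields_coords(1)[OF B Conf(1) c t a, of \<delta>]
        pullback_fields_coords(1)[OF B Conf(2) c' t a, of \<delta>] conn by simp
    from v_inj[OF this] have q': "inv f' (C' (yc t a) \<delta>) = q \<delta>" for \<delta>
      by (simp add: q_def)
    have "?v (0, inv f (J \<delta>)) = ?v (0, inv f' (J' \<delta>))" for \<delta>
      using pullback_fields_coords(2)[OF B Conf(1) c t a, of \<delta>]
        pullback_fields_coords(2)[OF B Conf(2) c' t a, of \<delta>] sold by simp
    from v_inj[OF this] have p': "inv f' (J' \<delta>) = p \<delta>" for \<delta>
      by (simp add: p_def)
    \<comment> \<open>Surjectivity of \<open>f\<close> pulls every block back to the material fibre,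
      where both configurations share the same \<open>p\<close> and \<open>q\<close>.\<close>
    have eqs: "J \<delta> = f (p \<delta>)" "C (yc t a) \<delta> = f (q \<delta>)" for \<delta>
      by (simp_all add: p_def q_def bij surj_f_inv_f bij_is_surj)
    have eqs': "J' \<delta> = f' (p \<delta>)" "C' (yc t a) \<delta> = f' (q \<delta>)" for \<delta>
      unfolding p'[symmetric] q'[symmetric] by (simp_all add: bij surj_f_inv_f bij_is_surj)
    have vert: "?v (0, \<eta>) \<in> vertical_at B a" for \<eta>
      using vertical_at_iff[OF B t a] v by simp
    have "pullback_metric B F a (?v (0, \<eta>)) (?v (0, \<eta>')) =
        pullback_metric B F' a (?v (0, \<eta>)) (?v (0, \<eta>'))" for \<eta> \<eta>'
      using fun_cong[OF fun_cong[OF fun_cong[OF mic, of a], of "?v (0, \<eta>)"], of "?v (0, \<eta>')"] a vert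
      by (simp add: micro_metric_def)
    then have ff: "f \<eta> \<bullet> f \<eta>' = f' \<eta> \<bullet> f' \<eta>'" for \<eta> \<eta>'
      by (simp add: pullback_metric_coords[OF B c t a refl] pullback_metric_coords[OF B c' t a refl] zero)
    \<comment> \<open>Each side is an inner product of two values of \<open>f\<close>, respectively
      \<open>f'\<close>, at the same vectors \<open>p \<delta> + q \<delta> + \<eta>\<close> and
      \<open>p \<delta>' + q \<delta>' + \<eta>'\<close>, so \<open>ff\<close> applies.\<close>
    have "pullback_metric B F a (?v (\<delta>, \<eta>)) (?v (\<delta>', \<eta>')) =
        pullback_metric B F' a (?v (\<delta>, \<eta>)) (?v (\<delta>', \<eta>'))" for \<delta> \<eta> \<delta>' \<eta>'
      unfolding pullback_metric_coords[OF B c t a refl] pullback_metric_coords[OF B c' t a refl] eqs eqs'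
      by (simp only: linear_add[OF lin(1), symmetric] linear_add[OF lin(2), symmetric] ff)
    moreover have "?v (snd U (total_chart B t)) = U" if "U \<in> tangent_at (total_manifold B) a" for U
      using t a by (intro tvec_of_coords_snd[OF M(1) _ _ that]) simp_all
    ultimately show ?thesis using uw by (metis prod.collapse)
  qed
  show ?thesis
  proof (intro iffI conjI; (elim conjE)?)
    assume G: "pullback_metric B F = pullback_metric B F'"
    show "micro_metric B (pullback_metric B F) = micro_metric B (pullback_metric B F')"
      using G by simp
    \<comment> \<open>The fields are restricted to their domains, so pointwise agreement there is
      equality of functions.\<close>
    show "pullback_connection B F = pullback_connection B F'"
      unfolding pullback_connection_def pullback_field_def
      using fields[OF G] unfolding pullback_connection_def
      by (intro bundle_fields_eqI[OF B] restrict_ext) (simp add: pullback_field_def)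
    show "pullback_solder B F = pullback_solder B F'"
      unfolding pullback_solder_def pullback_field_def
      using fields[OF G] unfolding pullback_solder_def
      by (intro bundle_fields_eqI[OF B] restrict_ext) (simp add: pullback_field_def)
  next
    assume "micro_metric B (pullback_metric B F) = micro_metric B (pullback_metric B F')"
      "pullback_connection B F = pullback_connection B F'"
      "pullback_solder B F = pullback_solder B F'"
    note metric = metric[OF this]
    show "pullback_metric B F = pullback_metric B F'"
      unfolding pullback_metric_def using metric
      by (intro bundle_fields_eqI[OF B] restrict_ext) (simp add: pullback_metric_def)
  qed
qed

end
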